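(* In the non-deterministic $\lambda$-calculus $\Lambda_\oplus$ the following hold: (1) $\to_\oplus$ satisfies head factorization: $\to_\oplus^*\subseteq\to_{\mathsf h\oplus}^*\cdot\to_{\neg\mathsf h\oplus}^*$; (2) $\to_{\neg\mathsf h\beta}\cdot\mapsto_\oplus\ \subseteq\ \to_{\mathsf h\oplus}\cdot\to_\beta^=$; (3) $\mapsto_\oplus$ is substitutive. Consequently $\to_\beta\cup\to_\oplus$ satisfies head factorization: $(\to_\beta\cup\to_\oplus)^*\subseteq(\to_{\mathsf h\beta}\cup\to_{\mathsf h\oplus})^*\cdot(\to_{\neg\mathsf h\beta}\cup\to_{\neg\mathsf h\oplus})^*$.
   Context: Terms of $\Lambda_\oplus$: $t::=x\mid\oplus\mid\lambda x.t\mid tt$, where $\oplus$ is a constant; modulo $\alpha$-equivalence, with capture-avoiding substitution $t\{x:=q\}$. Contexts: $C::=\langle\cdot\rangle\mid tC\mid Ct\mid\lambda x.C$. The contextual closure $\to_\rho$ of a root relation $\mapsto_\rho$: $C\langle r\rangle\to_\rho C\langle r'\rangle$ for $r\mapsto_\rho r'$. Rules: $(\lambda x.p)q\mapsto_\beta p\{x:=q\}$; $\oplus tp\mapsto_\oplus t$ and $\oplus tp\mapsto_\oplus p$. Head contexts: $H::=\lambda x_1\dots\lambda x_k.\langle\cdot\rangle t_1\dots t_n$ ($k,n\ge0$); non-head contexts are the other contexts. $\to_{\mathsf h\rho}$ (resp. $\to_{\neg\mathsf h\rho}$) is the closure of $\mapsto_\rho$ under head (resp. non-head) contexts. A root relation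 $\mapsto$ is substitutive if $r\mapsto r'$ implies $r\{x:=q\}\mapsto r'\{x:=q\}$ for all $x,q$. $\to^*$, $\to^=$ denote reflexive-transitive and reflexive closure; $R\cdot S$ is composition. *)

theory Defs
  imports Main
begin

text \<open>
  Terms modulo \<open>\<alpha>\<close>-equivalence are represented by de Bruijn terms: below \<open>d\<close> binders, the index
  \<open>d + x\<close> denotes the free variable \<open>x\<close>.
\<close>

datatype trm = Var nat | Oplus | Lam trm | App trm trm

primrec rename :: "(nat \<Rightarrow> nat) \<Rightarrow> trm \<Rightarrow> trm" where
  "rename f (Var x) = Var (f x)"
| "rename f Oplus = Oplus"
| "rename f (Lam t) = Lam (rename (case_nat 0 (Suc \<circ> f)) t)"
| "rename f (App t u) = App (rename f t) (rename f u)"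

text \<open>
  Simultaneous capture-avoiding substitution of \<open>s x\<close> for every free variable \<open>x\<close>; under a binder,
  the bound variable is kept and the substituted terms are shifted.
\<close>

primrec subst :: "(nat \<Rightarrow> trm) \<Rightarrow> trm \<Rightarrow> trm" where
  "subst s (Var x) = s x"
| "subst s Oplus = Oplus"
| "subst s (Lam t) = Lam (subst (case_nat (Var 0) (rename Suc \<circ> s)) t)"
| "subst s (App t u) = App (subst s t) (subst s u)"

text \<open>
  \<open>t{x:=q}\<close> for a free variable \<open>x\<close>: all other free variables are left unchanged.
\<close>

definition subst_var :: "trm \<Rightarrow> nat \<Rightarrow> trm \<Rightarrow> trm" where
  "subst_var t x q = subst (Var(x := q)) t"

text \<open>
  \<open>p{x:=q}\<close> where \<open>p\<close> is the body of an abstraction \<open>\<lambda>x.p\<close>: index \<open>0\<close> of \<open>p\<close> is replaced by \<open>q\<close>,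
  and index \<open>Suc y\<close> of \<open>p\<close> denotes the variable \<open>y\<close> outside the removed binder.
\<close>

definition subst_bound :: "trm \<Rightarrow> trm \<Rightarrow> trm" where
  "subst_bound p q = subst (case_nat q Var) p"

datatype ctx = Hole | CAppR trm ctx | CAppL ctx trm | CLam ctx

text \<open>Filling the hole may capture variables, so no shifting takes place.\<close>

primrec plug :: "ctx \<Rightarrow> trm \<Rightarrow> trm" where
  "plug Hole r = r"
| "plug (CAppR t C) r = App t (plug C r)"
| "plug (CAppL C t) r = App (plug C r) t"
| "plug (CLam C) r = Lam (plug C r)"

definition head_ctx :: "ctx \<Rightarrow> bool" where
  "head_ctx H \<longleftrightarrow> (\<exists>k ts. H = (CLam ^^ k) (foldl CAppL Hole ts))"

definition closure_under :: "(ctx \<Rightarrow> bool) \<Rightarrow> trm rel \<Rightarrow> trm rel" where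
  "closure_under P R = {(plug C r, plug C r') | C r r'. P C \<and> (r, r') \<in> R}"

definition ctx_closure :: "trm rel \<Rightarrow> trm rel" where
  "ctx_closure R = closure_under (\<lambda>C. True) R"

definition head_closure :: "trm rel \<Rightarrow> trm rel" where
  "head_closure R = closure_under head_ctx R"

definition nonhead_closure :: "trm rel \<Rightarrow> trm rel" where
  "nonhead_closure R = closure_under (\<lambda>C. \<not> head_ctx C) R"

inductive_set beta_root :: "trm rel" where
  "(App (Lam p) q, subst_bound p q) \<in> beta_root"

inductive_set oplus_root :: "trm rel" where
  oplus_left: "(App (App Oplus t) p, t) \<in> oplus_root"
| oplus_right: "(App (App Oplus t) p, p) \<in> oplus_root"

definition substitutive :: "trm rel \<Rightarrow> bool" where
  "substitutive R \<longleftrightarrow>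
     (\<forall>r r' x q. (r, r') \<in> R \<longrightarrow> (subst_var r x q, subst_var r' x q) \<in> R)"

end

theory Submission
  imports Defs
begin

text \<open>
  Following Loader and Kashima, call \<open>M\<close> standardly reducible to \<open>N\<close> if weak head steps (steps in
  contexts \<open>\<langle>\<cdot>\<rangle> t\<^sub>1 \<dots> t\<^sub>n\<close>) lead from \<open>M\<close> to a term with the same outermost constructor as \<open>N\<close>, whose
  immediate subterms are in turn standardly reducible to those of \<open>N\<close>. This relation is stable under
  substitution, and it absorbs a root \<open>\<beta>\<close>- or \<open>\<oplus>\<close>-step on the right: the redex already shows up
  after weak head steps on the left. Hence it contains all reduction sequences. Reading a standard
  reduction from the outside in, the weak head steps come first; under an abstraction one recurses,
  and in the function part of an application every step that is not weak head is also not head. The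
  argument is uniform in the root relation, so it covers both \<open>\<oplus>\<close> alone and \<open>\<beta> \<union> \<oplus>\<close>.
\<close>

section \<open>Substitution\<close>

lemma rename_eq_subst: "rename f t = subst (Var \<circ> f) t"
proof (induction t arbitrary: f)
  case (Lam t)
  have "Var \<circ> case_nat 0 (Suc \<circ> f) = case_nat (Var 0) (rename Suc \<circ> (Var \<circ> f))"
    by (auto split: nat.split)
  then show ?case by (simp only: rename.simps subst.simps Lam.IH)
qed auto

lemma subst_rename: "subst s (rename f t) = subst (s \<circ> f) t"
proof (induction t arbitrary: s f)
  case (Lam t)
  have "case_nat (Var 0) (rename Suc \<circ> s) \<circ> case_nat 0 (Suc \<circ> f)
      = case_nat (Var 0) (rename Suc \<circ> (s \<circ> f))"
    by (auto split: nat.split)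
  then show ?case by (simp only: rename.simps subst.simps Lam.IH)
qed auto

lemma rename_rename: "rename g (rename f t) = rename (g \<circ> f) t"
  by (simp add: rename_eq_subst[of g] rename_eq_subst[of "g \<circ> f"] subst_rename comp_assoc)

lemma rename_subst: "rename f (subst s t) = subst (rename f \<circ> s) t"
proof (induction t arbitrary: s f)
  case (Lam t)
  have "rename (case_nat 0 (Suc \<circ> f)) \<circ> case_nat (Var 0) (rename Suc \<circ> s)
      = case_nat (Var 0) (rename Suc \<circ> (rename f \<circ> s))"
    by (auto split: nat.split simp: rename_rename comp_def)
  then show ?case by (simp only: rename.simps subst.simps Lam.IH)
qed auto

text \<open>Lifted substitutions compose only if a shift can pass through \<open>subst\<close> on
  either side; that is what \<open>subst_rename\<close> and \<open>rename_subst\<close>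
  provide.\<close>

lemma subst_subst: "subst s (subst s' t) = subst (subst s \<circ> s') t"
proof (induction t arbitrary: s s')
  case (Lam t)
  have "subst (case_nat (Var 0) (rename Suc \<circ> s)) \<circ> case_nat (Var 0) (rename Suc \<circ> s')
      = case_nat (Var 0) (rename Suc \<circ> (subst s \<circ> s'))"
    by (auto split: nat.split simp: subst_rename rename_subst comp_def)
  then show ?case by (simp only: rename.simps subst.simps Lam.IH)
qed auto

lemma subst_Var: "subst Var t = t"
proof (induction t)
  case (Lam t)
  have "case_nat (Var 0) (rename Suc \<circ> Var) = Var"
    by (auto split: nat.split)
  then show ?case using Lam by simp
qed auto

lemma subst_subst_bound:
  "subst s (subst_bound p q) = subst_bound (subst (case_nat (Var 0) (rename Suc \<circ> s)) p) (subst s q)"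
proof -
  \<comment> \<open>At index 0 both sides give \<open>subst s q\<close>; at \<open>Suc y\<close> the
    shift in \<open>rename Suc (s y)\<close> is cancelled by \<open>case_nat _ Var\<close>, which
    leaves \<open>s y\<close>.\<close>
  have "subst s \<circ> case_nat q Var
      = subst (case_nat (subst s q) Var) \<circ> case_nat (Var 0) (rename Suc \<circ> s)"
    by (auto split: nat.split simp: subst_rename comp_def subst_Var)
  then show ?thesis
    by (simp add: subst_bound_def subst_subst)
qed

text \<open>Simultaneous substitutions can be lifted under binders, and they cover
  \<open>subst_var\<close> and \<open>subst_bound\<close> alike.\<close>

definition subst_closed :: "trm rel \<Rightarrow> bool" where
  "subst_closed R \<longleftrightarrow> (\<forall>t u s. (t, u) \<in> R \<longrightarrow> (subst s t, subst s u) \<in> R)"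

lemma subst_closedD: "subst_closed R \<Longrightarrow> (t, u) \<in> R \<Longrightarrow> (subst s t, subst s u) \<in> R"
  by (auto simp: subst_closed_def)

lemma subst_closed_Un: "subst_closed R \<Longrightarrow> subst_closed S \<Longrightarrow> subst_closed (R \<union> S)"
  by (auto simp: subst_closed_def)

lemma subst_closed_rtrancl:
  assumes "subst_closed R"
  shows "subst_closed (R\<^sup>*)"
proof -
  have "(subst s t, subst s u) \<in> R\<^sup>*" if "(t, u) \<in> R\<^sup>*" for s t u
    using that by induction (auto intro: rtrancl_into_rtrancl subst_closedD[OF assms])
  then show ?thesis by (simp add: subst_closed_def)
qed

lemma subst_closed_beta_root: "subst_closed beta_root"
  by (auto simp: subst_closed_def elim!: beta_root.cases)
    (simp add: subst_subst_bound beta_root.intros)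

lemma subst_closed_oplus_root: "subst_closed oplus_root"
  by (auto simp: subst_closed_def elim!: oplus_root.cases intro: oplus_root.intros)

section \<open>Contexts\<close>

text \<open>Head contexts without leading abstractions, given by recursion so that induction on the
  context applies.\<close>

primrec weak_ctx :: "ctx \<Rightarrow> bool" where
  "weak_ctx Hole = True"
| "weak_ctx (CAppR t C) = False"
| "weak_ctx (CAppL C t) = weak_ctx C"
| "weak_ctx (CLam C) = False"

lemma weak_ctx_iff_foldl: "weak_ctx C \<longleftrightarrow> (\<exists>ts. C = foldl CAppL Hole ts)"
proof
  assume "weak_ctx C"
  then show "\<exists>ts. C = foldl CAppL Hole ts"
  proof (induction C)
    case Hole
    have "Hole = foldl CAppL Hole []" by simp
    then show ?case by blast
  next
    case (CAppL C t)
    then obtain ts where "C = foldl CAppL Hole ts" by auto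
    then have "CAppL C t = foldl CAppL Hole (ts @ [t])" by simp
    then show ?case by blast
  qed auto
next
  have "weak_ctx (foldl CAppL Hole ts)" for ts
    by (induction ts rule: rev_induct) auto
  then show "\<exists>ts. C = foldl CAppL Hole ts \<Longrightarrow> weak_ctx C" by blast
qed

lemma head_ctx_iff_weak_ctx: "head_ctx C \<longleftrightarrow> (\<exists>k D. C = (CLam ^^ k) D \<and> weak_ctx D)"
  unfolding head_ctx_def weak_ctx_iff_foldl by blast

lemma head_ctx_simps [simp]:
  "head_ctx Hole"
  "\<not> head_ctx (CAppR t C)"
  "head_ctx (CAppL C t) \<longleftrightarrow> weak_ctx C"
  "head_ctx (CLam C) \<longleftrightarrow> head_ctx C"
proof -
  \<comment> \<open>A head context that does not start with an abstraction must have
    \<open>k = 0\<close>.\<close>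
  have nonlam: "head_ctx D \<longleftrightarrow> weak_ctx D" if "\<And>E. D \<noteq> CLam E" for D
  proof
    assume "head_ctx D"
    then obtain k E where "D = (CLam ^^ k) E" "weak_ctx E"
      by (auto simp: head_ctx_iff_weak_ctx)
    then show "weak_ctx D" using that by (cases k) auto
  next
    assume "weak_ctx D"
    then have "D = (CLam ^^ 0) D \<and> weak_ctx D" by simp
    then show "head_ctx D" unfolding head_ctx_iff_weak_ctx by blast
  qed
  show "head_ctx Hole" "\<not> head_ctx (CAppR t C)" "head_ctx (CAppL C t) \<longleftrightarrow> weak_ctx C"
    by (simp_all add: nonlam)
  show "head_ctx (CLam C) \<longleftrightarrow> head_ctx C"
  proof
    assume "head_ctx (CLam C)"
    then obtain k E where "CLam C = (CLam ^^ k) E" "weak_ctx E"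
      by (auto simp: head_ctx_iff_weak_ctx)
    then show "head_ctx C" by (cases k) (auto simp: head_ctx_iff_weak_ctx)
  next
    assume "head_ctx C"
    then obtain k E where "CLam C = (CLam ^^ Suc k) E" "weak_ctx E"
      by (auto simp: head_ctx_iff_weak_ctx)
    then show "head_ctx (CLam C)" unfolding head_ctx_iff_weak_ctx by blast
  qed
qed

lemma weak_ctx_imp_head_ctx: "weak_ctx C \<Longrightarrow> head_ctx C"
  by (cases C) auto

lemma closure_underI: "P C \<Longrightarrow> (r, r') \<in> R \<Longrightarrow> (plug C r, plug C r') \<in> closure_under P R"
  by (auto simp: closure_under_def)

lemma closure_under_mono: "(\<And>C. P C \<Longrightarrow> Q C) \<Longrightarrow> closure_under P R \<subseteq> closure_under Q R"
  by (auto simp: closure_under_def)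

lemma closure_under_Un: "closure_under P (R \<union> S) = closure_under P R \<union> closure_under P S"
  by (auto simp: closure_under_def)

text \<open>Here \<open>f\<close> extends the context and \<open>g\<close> extends the term in the
  same way, while \<open>P\<close> and \<open>Q\<close> track how the class of the context
  changes.\<close>

lemma closure_under_step:
  assumes "(t, u) \<in> closure_under P R" "\<And>C. P C \<Longrightarrow> Q (f C)" "\<And>C r. plug (f C) r = g (plug C r)"
  shows "(g t, g u) \<in> closure_under Q R"
  using assms closure_underI[of Q "f _"] by (fastforce simp: closure_under_def)

lemma closure_under_steps:
  assumes "(t, u) \<in> (closure_under P R)\<^sup>*" "\<And>C. P C \<Longrightarrow> Q (f C)" "\<And>C r. plug (f C) r = g (plug C r)"
  shows "(g t, g u) \<in> (closure_under Q R)\<^sup>*"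
  using assms(1)
proof induction
  case (step u v)
  have "(g u, g v) \<in> closure_under Q R"
    using step.hyps(2) assms(2,3) by (rule closure_under_step)
  with step.IH show ?case by (rule rtrancl_into_rtrancl)
qed auto

section \<open>Standard reduction\<close>

abbreviation weak_closure :: "trm rel \<Rightarrow> trm rel" where
  "weak_closure \<equiv> closure_under weak_ctx"

lemma weak_root: "(t, u) \<in> R \<Longrightarrow> (t, u) \<in> weak_closure R"
  using closure_underI[of weak_ctx Hole] by simp

lemma weak_App: "(t, u) \<in> (weak_closure R)\<^sup>* \<Longrightarrow> (App t q, App u q) \<in> (weak_closure R)\<^sup>*"
  by (rule closure_under_steps[where f = "\<lambda>C. CAppL C q"]) auto

text \<open>The hole of a weak context lies under no binder, so the substitution reaches the redex
  without being lifted.\<close>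

lemma subst_closed_weak_closure:
  assumes "subst_closed R"
  shows "subst_closed (weak_closure R)"
proof -
  have "(subst s (plug C r), subst s (plug C r')) \<in> weak_closure R"
    if "weak_ctx C" "(r, r') \<in> R" for s C r r'
    using that(1)
  proof (induction C)
    case Hole
    then show ?case using that(2) by (simp add: weak_root subst_closedD[OF assms])
  next
    case (CAppL C t)
    then show ?case
      using closure_under_step[where f = "\<lambda>C. CAppL C (subst s t)"
          and g = "\<lambda>p. App p (subst s t)" and P = weak_ctx and Q = weak_ctx] by simp
  qed auto
  then show ?thesis by (auto simp: subst_closed_def closure_under_def)
qed

inductive std :: "trm rel \<Rightarrow> trm \<Rightarrow> trm \<Rightarrow> bool" for R where
  std_Var: "(m, Var x) \<in> (weak_closure R)\<^sup>* \<Longrightarrow> std R m (Var x)"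
| std_Oplus: "(m, Oplus) \<in> (weak_closure R)\<^sup>* \<Longrightarrow> std R m Oplus"
| std_Lam: "(m, Lam p) \<in> (weak_closure R)\<^sup>* \<Longrightarrow> std R p p' \<Longrightarrow> std R m (Lam p')"
| std_App: "(m, App p q) \<in> (weak_closure R)\<^sup>* \<Longrightarrow> std R p p' \<Longrightarrow> std R q q' \<Longrightarrow> std R m (App p' q')"

inductive_cases std_OplusE: "std R m Oplus"
inductive_cases std_LamE: "std R m (Lam p)"
inductive_cases std_AppE: "std R m (App p q)"

lemma std_refl: "std R t t"
  by (induction t) (auto intro: std.intros)

text \<open>Each rule of \<open>std\<close> starts with a weak reduction sequence, to which another
  one can be prepended.\<close>

lemma weak_std: "(m, n) \<in> (weak_closure R)\<^sup>* \<Longrightarrow> std R n p \<Longrightarrow> std R m p"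
  by (erule std.cases) (auto intro: std.intros rtrancl_trans)

text \<open>The parameter \<open>P\<close> allows two uses: equality of the substitutions gives
  \<open>std_rename\<close>, and pointwise \<open>std\<close>, whose lifting relies on
  \<open>std_rename\<close>, gives \<open>std_subst\<close>.\<close>

lemma std_subst_of_lifting:
  assumes R: "subst_closed R"
    and lift: "\<And>s s'. \<lbrakk>\<And>x. P s s' x\<rbrakk> \<Longrightarrow>
      (\<And>x. P (case_nat (Var 0) (rename Suc \<circ> s)) (case_nat (Var 0) (rename Suc \<circ> s')) x)"
    and var: "\<And>s s' x. P s s' x \<Longrightarrow> std R (s x) (s' x)"
    and m: "std R m m'" and s: "\<And>x. P s s' x"
  shows "std R (subst s m) (subst s' m')"
  using m s
proof (induction arbitrary: s s')
  note weak = subst_closedD[OF subst_closed_rtrancl[OF subst_closed_weak_closure[OF R]]]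
  {
    case (std_Var m x)
    \<comment> \<open>Weak steps lead from \<open>subst s m\<close> to \<open>s x\<close>, and a
      standard reduction from there to \<open>s' x\<close>.\<close>
    then show ?case using weak[OF std_Var(1), of s] var by (auto intro: weak_std)
  next
    case (std_Oplus m)
    then show ?case using weak[OF std_Oplus(1), of s] by (auto intro: std.intros)
  next
    case (std_Lam m p p')
    have "std R (subst (case_nat (Var 0) (rename Suc \<circ> s)) p)
        (subst (case_nat (Var 0) (rename Suc \<circ> s')) p')"
      by (intro std_Lam.IH lift std_Lam.prems)
    then show ?case using weak[OF std_Lam(1), of s] by (auto intro: std.intros)
  next
    case (std_App m p q p' q')
    then show ?case using weak[OF std_App(1), of s] by (auto intro: std.intros)
  }
qed

lemma std_rename:
  assumes "subst_closed R" "std R m m'"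
  shows "std R (rename f m) (rename f m')"
  unfolding rename_eq_subst
  by (rule std_subst_of_lifting[OF assms(1), where P = "\<lambda>s s' x. s = s'"])
    (auto intro: std_refl assms)

lemma std_subst:
  assumes "subst_closed R" "std R m m'" "\<And>x. std R (s x) (s' x)"
  shows "std R (subst s m) (subst s' m')"
  by (rule std_subst_of_lifting[OF assms(1), where P = "\<lambda>s s' x. std R (s x) (s' x)"])
    (auto intro: std_refl std_rename assms split: nat.split)

lemma std_subst_bound:
  assumes "subst_closed R" "std R p p'" "std R q q'"
  shows "std R (subst_bound p q) (subst_bound p' q')"
  unfolding subst_bound_def
  by (rule std_subst[OF assms(1,2)]) (auto intro: std_refl assms split: nat.split)

lemma std_beta_root:
  assumes R: "subst_closed R" "beta_root \<subseteq> R" and m: "std R m t" and tu: "(t, u) \<in> beta_root"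
  shows "std R m u"
proof -
  from tu obtain p' q' where t: "t = App (Lam p') q'" and u: "u = subst_bound p' q'"
    by (auto elim: beta_root.cases)
  from m[unfolded t] obtain a q where 1: "(m, App a q) \<in> (weak_closure R)\<^sup>*"
    and a: "std R a (Lam p')" and q: "std R q q'"
    by (auto elim: std_AppE)
  from a obtain p where 2: "(a, Lam p) \<in> (weak_closure R)\<^sup>*" and p: "std R p p'"
    by (auto elim: std_LamE)
  \<comment> \<open>The redex stands at the root, so its contraction only prolongs the weak
    prefix.\<close>
  have "(App (Lam p) q, subst_bound p q) \<in> weak_closure R"
    using R(2) by (auto intro: weak_root beta_root.intros)
  then have "(m, subst_bound p q) \<in> (weak_closure R)\<^sup>*"
    using 1 weak_App[OF 2, of q] by (meson rtrancl_trans rtrancl_into_rtrancl)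
  then show ?thesis
    unfolding u by (rule weak_std[OF _ std_subst_bound[OF R(1) p q]])
qed

text \<open>Inverting three times exposes the redex \<open>App (App Oplus p) q\<close> after weak
  steps. Its contractum is \<open>p\<close> or \<open>q\<close>, from which a standard reduction to
  \<open>p'\<close> or \<open>q'\<close> is at hand.\<close>

lemma std_oplus_root:
  assumes R: "oplus_root \<subseteq> R" and m: "std R m t" and tu: "(t, u) \<in> oplus_root"
  shows "std R m u"
proof -
  from tu obtain p' q' where t: "t = App (App Oplus p') q'" and u: "u = p' \<or> u = q'"
    by (auto elim: oplus_root.cases)
  from m[unfolded t] obtain a q where 1: "(m, App a q) \<in> (weak_closure R)\<^sup>*"
    and a: "std R a (App Oplus p')" and q: "std R q q'"
    by (auto elim: std_AppE)
  from a obtain b p where 2: "(a, App b p) \<in> (weak_closure R)\<^sup>*"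
    and 3: "(b, Oplus) \<in> (weak_closure R)\<^sup>*" and p: "std R p p'"
    by (auto elim!: std_AppE std_OplusE)
  have redex: "(m, App (App Oplus p) q) \<in> (weak_closure R)\<^sup>*"
    using 1 weak_App[OF 2, of q] weak_App[OF weak_App[OF 3, of p], of q] by (meson rtrancl_trans)
  have "(App (App Oplus p) q, p) \<in> weak_closure R" "(App (App Oplus p) q, q) \<in> weak_closure R"
    using R by (auto intro: weak_root oplus_root.intros)
  then have "(m, p) \<in> (weak_closure R)\<^sup>*" "(m, q) \<in> (weak_closure R)\<^sup>*"
    using redex by (auto intro: rtrancl_into_rtrancl)
  then show ?thesis using u p q by (auto intro: weak_std)
qed

text \<open>Inversion at each constructor on the path to the hole passes to a subterm of a weak
  reduct of \<open>m\<close>, so \<open>m\<close> must vary in the induction.\<close>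

lemma std_plug:
  assumes "\<And>m t u. std R m t \<Longrightarrow> (t, u) \<in> R \<Longrightarrow> std R m u" and "(r, r') \<in> R"
  shows "std R m (plug C r) \<Longrightarrow> std R m (plug C r')"
  by (induction C arbitrary: m) (auto elim!: std_LamE std_AppE intro: std.intros assms)

lemma ctx_closure_rtrancl_std:
  assumes "\<And>m t u. std R m t \<Longrightarrow> (t, u) \<in> R \<Longrightarrow> std R m u" and "(m, n) \<in> (ctx_closure R)\<^sup>*"
  shows "std R m n"
  using assms(2)
proof induction
  case base
  show ?case by (rule std_refl)
next
  case (step y z)
  then show ?case
    using std_plug[of R, OF assms(1)] by (auto simp: ctx_closure_def closure_under_def)
qed

section \<open>Factorization\<close>

text \<open>Needed for the function part of an application: \<open>CAppL C t\<close> is a head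
  context exactly if \<open>C\<close> is weak.\<close>

lemma std_weak_factorization:
  "std R m n \<Longrightarrow> (m, n) \<in> (weak_closure R)\<^sup>* O (closure_under (\<lambda>C. \<not> weak_ctx C) R)\<^sup>*"
proof (induction rule: std.induct)
  let ?w = "weak_closure R" and ?n = "closure_under (\<lambda>C. \<not> weak_ctx C) R"
  have all: "(t, u) \<in> (closure_under (\<lambda>C. True) R)\<^sup>*" if "(t, u) \<in> ?w\<^sup>* O ?n\<^sup>*" for t u
    using that rtrancl_mono[OF closure_under_mono, of weak_ctx "\<lambda>C. True"]
      rtrancl_mono[OF closure_under_mono, of "\<lambda>C. \<not> weak_ctx C" "\<lambda>C. True"]
    by (blast intro: rtrancl_trans)
  {
    case (std_Lam m p p')
    \<comment> \<open>No step under an abstraction is weak, so the split given by the induction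
      hypothesis is forgotten.\<close>
    have "(Lam p, Lam p') \<in> ?n\<^sup>*"
      by (rule closure_under_steps[OF all[OF std_Lam.IH], where f = CLam]) auto
    then show ?case using std_Lam(1) by blast
  next
    case (std_App m p q p' q')
    obtain p1 where p1: "(p, p1) \<in> ?w\<^sup>*" "(p1, p') \<in> ?n\<^sup>*" using std_App.IH(1) by blast
    have "(App p1 q, App p' q) \<in> ?n\<^sup>*"
      by (rule closure_under_steps[OF p1(2), where f = "\<lambda>C. CAppL C q"]) auto
    moreover have "(App p' q, App p' q') \<in> ?n\<^sup>*"
      by (rule closure_under_steps[OF all[OF std_App.IH(2)], where f = "CAppR p'"]) auto
    ultimately show ?case
      using std_App(1) weak_App[OF p1(1), of q] by (meson relcompI rtrancl_trans)
  }
qed auto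

lemma std_head_factorization:
  "std R m n \<Longrightarrow> (m, n) \<in> (head_closure R)\<^sup>* O (nonhead_closure R)\<^sup>*"
  unfolding head_closure_def nonhead_closure_def
proof (induction rule: std.induct)
  let ?h = "closure_under head_ctx R" and ?n = "closure_under (\<lambda>C. \<not> head_ctx C) R"
  have wh: "(weak_closure R)\<^sup>* \<subseteq> ?h\<^sup>*"
    by (intro rtrancl_mono closure_under_mono weak_ctx_imp_head_ctx)
  {
    case (std_Var m x)
    then show ?case using wh by blast
  next
    case (std_Oplus m)
    then show ?case using wh by blast
  next
    case (std_Lam m p p')
    obtain p1 where p1: "(p, p1) \<in> ?h\<^sup>*" "(p1, p') \<in> ?n\<^sup>*" using std_Lam.IH by blast
    have "(Lam p, Lam p1) \<in> ?h\<^sup>*"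
      by (rule closure_under_steps[OF p1(1), where f = CLam]) auto
    moreover have "(Lam p1, Lam p') \<in> ?n\<^sup>*"
      by (rule closure_under_steps[OF p1(2), where f = CLam]) auto
    ultimately show ?case using std_Lam(1) wh by (meson relcompI rtrancl_trans subsetD)
  next
    case (std_App m p q p' q')
    \<comment> \<open>The induction hypothesis for \<open>p\<close> would not suffice: a head step
      of \<open>p\<close> under an abstraction is no head step of \<open>App p q\<close>.\<close>
    obtain p1 where p1: "(p, p1) \<in> (weak_closure R)\<^sup>*"
      "(p1, p') \<in> (closure_under (\<lambda>C. \<not> weak_ctx C) R)\<^sup>*"
      using std_weak_factorization[OF std_App(2)] by blast
    \<comment> \<open>In the argument of an application all steps are non-head.\<close>
    have "(q, q') \<in> (closure_under (\<lambda>C. True) R)\<^sup>*"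
      using std_App.IH(2) rtrancl_mono[OF closure_under_mono, of head_ctx "\<lambda>C. True"]
        rtrancl_mono[OF closure_under_mono, of "\<lambda>C. \<not> head_ctx C" "\<lambda>C. True"]
      by (blast intro: rtrancl_trans)
    then have "(App p' q, App p' q') \<in> ?n\<^sup>*"
      by (rule closure_under_steps[where f = "CAppR p'"]) auto
    moreover have "(App p1 q, App p' q) \<in> ?n\<^sup>*"
      by (rule closure_under_steps[OF p1(2), where f = "\<lambda>C. CAppL C q"]) auto
    ultimately show ?case
      using std_App(1) weak_App[OF p1(1), of q] wh by (meson relcompI rtrancl_trans subsetD)
  }
qed

lemma head_factorization:
  assumes "\<And>m t u. std R m t \<Longrightarrow> (t, u) \<in> R \<Longrightarrow> std R m u"
  shows "(ctx_closure R)\<^sup>* \<subseteq> (head_closure R)\<^sup>* O (nonhead_closure R)\<^sup>*"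
proof (rule subrelI)
  fix m n assume "(m, n) \<in> (ctx_closure R)\<^sup>*"
  with assms have "std R m n" by (rule ctx_closure_rtrancl_std)
  then show "(m, n) \<in> (head_closure R)\<^sup>* O (nonhead_closure R)\<^sup>*" by (rule std_head_factorization)
qed

lemma plug_eq_Oplus: "plug C r = Oplus \<longleftrightarrow> C = Hole \<and> r = Oplus"
  by (cases C) auto

text \<open>Since its context is not head, the \<beta>-redex lies in one of the two arguments of
  \<open>Oplus\<close>, so the \<oplus>-redex is already present. Firing it first either keeps the
  \<beta>-step or erases it, hence the reflexive closure.\<close>

lemma nonhead_beta_oplus_root:
  "nonhead_closure beta_root O oplus_root \<subseteq> head_closure oplus_root O (ctx_closure beta_root)\<^sup>="
proof (rule subrelI)
  fix m n assume "(m, n) \<in> nonhead_closure beta_root O oplus_root"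
  then obtain C r r' where m: "m = plug C r" and C: "\<not> head_ctx C" and r: "(r, r') \<in> beta_root"
    and n: "(plug C r', n) \<in> oplus_root"
    by (auto simp: nonhead_closure_def closure_under_def)
  from n obtain t p where tp: "plug C r' = App (App Oplus t) p" "n = t \<or> n = p"
    by (auto elim: oplus_root.cases)
  have beta: "(plug D r, plug D r') \<in> ctx_closure beta_root" for D
    unfolding ctx_closure_def using r by (intro closure_underI) auto
  have "\<exists>t' p'. m = App (App Oplus t') p' \<and>
      (t', t) \<in> (ctx_closure beta_root)\<^sup>= \<and> (p', p) \<in> (ctx_closure beta_root)\<^sup>="
  proof (cases C)
    case (CAppR u D)
    then show ?thesis using tp beta m by auto
  next
    case CL: (CAppL D u)
    then show ?thesis
    proof (cases D)
      case (CAppR v E)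
      then show ?thesis using tp beta m CL by auto
    next
      case (CAppL E v)
      \<comment> \<open>The contractum would have to be \<open>Oplus\<close> itself, with
        \<open>E = Hole\<close>; but then \<open>C\<close> is a head context.\<close>
      then show ?thesis using tp C CL by (auto simp: plug_eq_Oplus)
    qed (use tp C CL in auto)
  qed (use tp C in auto)
  then obtain t' p' where m': "m = App (App Oplus t') p'"
    and b: "(t', t) \<in> (ctx_closure beta_root)\<^sup>=" "(p', p) \<in> (ctx_closure beta_root)\<^sup>=" by blast
  have "(m, t') \<in> head_closure oplus_root" "(m, p') \<in> head_closure oplus_root"
    unfolding m' head_closure_def
    using closure_underI[of head_ctx Hole] by (auto intro: oplus_root.intros)
  then show "(m, n) \<in> head_closure oplus_root O (ctx_closure beta_root)\<^sup>="
    using tp(2) b by blast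
qed

theorem theorem5p3:
  shows "(ctx_closure oplus_root)\<^sup>* \<subseteq> (head_closure oplus_root)\<^sup>* O (nonhead_closure oplus_root)\<^sup>* \<and>
    nonhead_closure beta_root O oplus_root \<subseteq> head_closure oplus_root O (ctx_closure beta_root)\<^sup>= \<and>
    substitutive oplus_root \<and>
    (ctx_closure beta_root \<union> ctx_closure oplus_root)\<^sup>*
      \<subseteq> (head_closure beta_root \<union> head_closure oplus_root)\<^sup>*
        O (nonhead_closure beta_root \<union> nonhead_closure oplus_root)\<^sup>*"
proof (intro conjI)
  show "(ctx_closure oplus_root)\<^sup>* \<subseteq> (head_closure oplus_root)\<^sup>* O (nonhead_closure oplus_root)\<^sup>*"
    by (rule head_factorization) (rule std_oplus_root[OF subset_refl])
  show "nonhead_closure beta_root O oplus_root \<subseteq> head_closure oplus_root O (ctx_closure beta_root)\<^sup>="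
    by (rule nonhead_beta_oplus_root)
  show "substitutive oplus_root"
    unfolding substitutive_def subst_var_def using subst_closedD[OF subst_closed_oplus_root] by blast
  let ?R = "beta_root \<union> oplus_root"
  \<comment> \<open>With the union as root relation, weak prefixes may mix \<beta>- and
    \<oplus>-steps. Closures distribute over the union, which gives the form stated.\<close>
  have "std ?R m u" if "std ?R m t" "(t, u) \<in> ?R" for m t u
    using that std_beta_root[of ?R m t u] std_oplus_root[of ?R m t u]
      subst_closed_Un[OF subst_closed_beta_root subst_closed_oplus_root] by blast
  then have "(ctx_closure ?R)\<^sup>* \<subseteq> (head_closure ?R)\<^sup>* O (nonhead_closure ?R)\<^sup>*"
    by (rule head_factorization)
  then show "(ctx_closure beta_root \<union> ctx_closure oplus_root)\<^sup>*
      \<subseteq> (head_closure beta_root \<union> head_closure oplus_root)\<^sup>*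
        O (nonhead_closure beta_root \<union> nonhead_closure oplus_root)\<^sup>*"
    by (simp add: ctx_closure_def head_closure_def nonhead_closure_def closure_under_Un)
qed

end
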